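(* Let $t\ge 1$, $n\ge 2$ be integers and let $p\ge 9$ be odd. Every graph $G\in\mathcal L_t(p,n)$ (that is, every LAU graph) satisfies $\chi_{la}(G)=3$.
   Context: Local antimagic chromatic number: for a graph $G=(V,E)$ (possibly disconnected, with no $K_2$ component) a bijection $f:E\to\{1,\dots,|E|\}$ is a local antimagic labeling if $f^+(u)\ne f^+(v)$ for every edge $uv\in E$, where $f^+(u)$ is the sum of $f(e)$ over all edges $e$ incident to $u$. $\chi_{la}(G)$ is the minimum, over all local antimagic labelings $f$ of $G$, of the number of distinct values of $f^+$ on $V$. Luv graphs and LAU graphs: let $p\ge 9$ be odd and $n\ge2$. A Luv graph with parameters $(p,n)$ is a simple graph on $p$ vertices $u_1,\dots,u_p$ whose edge set is $\bigcup_{\phi=1}^n (E^\phi\cup F^\phi)$, where: (1) $E^1=\{u_iu_{i+1}: 1\le i\le p-1\}$; (2) for $2\le\phi\le n$, $E^\phi=\{u_{j^\phi_i}u_{j^\phi_{i+1}}:1\le i\le p-1\}$, where $(j^\phi_1,\dots,j^\phi_p)$ is a permutation of $\{1,\dots,p\}$ with $j^\phi_1=1$, $j^\phi_p=p$ and $|j^\phi_{i+1}-j^\phi_i|$ odd and $\ge 3$ for all $1\le i\le p-1$; moreover $E^\phi\cap E^{\phi'}=\varnothing$ for $2\le\phi\ne\phi'\le n$; (3) $F^\phi=\{u_1u_{2a^\phi+1},\,u_pu_{2a^\phi+1}\}$ for $1\le\phi\le n$, where $a^1,\dots,a^n$ are pairwise distinct integers in $[1,\frac{p-3}{2}]$.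 Such a graph has $n$ vertices of degree $2n+2$ (the $u_{2a^\phi+1}$), $p-n$ vertices of degree $2n$, and $n(p+1)$ edges. For $t\ge1$, $\mathcal L_t(p,n)$ is the family of all graphs that are disjoint unions of $t$ Luv graphs with parameters $(p,n)$ (the choices of the paths and of the $a^\phi$ may differ between components). Its members are called LAU graphs. *)

theory Defs
  imports Main "HOL-Library.Disjoint_Sets"
begin

text \<open>A graph is a pair of a vertex set and a set of edges, an edge being a two-element set.\<close>

type_synonym 'a ugraph = "'a set \<times> 'a set set"

abbreviation verts :: "'a ugraph \<Rightarrow> 'a set" where "verts G \<equiv> fst G"

abbreviation edges :: "'a ugraph \<Rightarrow> 'a set set" where "edges G \<equiv> snd G"

definition simple_graph :: "'a ugraph \<Rightarrow> bool" where
  "simple_graph G \<longleftrightarrow> finite (verts G) \<and> (\<forall>e\<in>edges G. e \<subseteq> verts G \<and> card e = 2)"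

definition vertex_sum :: "'a ugraph \<Rightarrow> ('a set \<Rightarrow> nat) \<Rightarrow> 'a \<Rightarrow> nat" where
  "vertex_sum G f v = (\<Sum>e | e \<in> edges G \<and> v \<in> e. f e)"

definition local_antimagic_labeling :: "'a ugraph \<Rightarrow> ('a set \<Rightarrow> nat) \<Rightarrow> bool" where
  "local_antimagic_labeling G f \<longleftrightarrow>
     bij_betw f (edges G) {1..card (edges G)} \<and>
     (\<forall>u v. {u, v} \<in> edges G \<longrightarrow> vertex_sum G f u \<noteq> vertex_sum G f v)"

text \<open>If there is no local antimagic labeling at all, the infimum is \<open>0\<close>. For every other
  graph it is an attained minimum, and it is positive as soon as \<open>verts G\<close> is finite and
  nonempty; so a positive value always asserts that a labeling exists.\<close>

definition chi_la :: "'a ugraph \<Rightarrow> nat" where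
  "chi_la G = Inf {card (vertex_sum G f ` verts G) | f. local_antimagic_labeling G f}"

definition path_edges :: "nat \<Rightarrow> (nat \<Rightarrow> 'a) \<Rightarrow> 'a set set" where
  "path_edges p w = {{w i, w (Suc i)} | i. 1 \<le> i \<and> i \<le> p - 1}"

text \<open>Here \<open>u i\<close> is the vertex \<open>u\<^sub>i\<close> and \<open>j \<phi> i\<close> is the index \<open>j\<^sup>\<phi>\<^sub>i\<close>, relevant only for
  \<open>2 \<le> \<phi> \<le> n\<close>. The first path \<open>E\<^sup>1\<close> is \<open>path_edges p u\<close>, and the disjointness
  requirement concerns the paths with \<open>\<phi> \<ge> 2\<close> only. The definition is meant for
  odd \<open>p \<ge> 9\<close> and \<open>n \<ge> 2\<close>, so that \<open>(p - 3) div 2\<close> is exact.\<close>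

definition Luv :: "nat \<Rightarrow> nat \<Rightarrow> 'a ugraph set" where
  "Luv p n = {G. \<exists>u j a.
     bij_betw u {1..p} (verts G) \<and>
     (\<forall>\<phi>\<in>{2..n}. bij_betw (j \<phi>) {1..p} {1..p} \<and> j \<phi> 1 = 1 \<and> j \<phi> p = p \<and>
        (\<forall>i\<in>{1..p - 1}. odd \<bar>int (j \<phi> (Suc i)) - int (j \<phi> i)\<bar> \<and>
                         \<bar>int (j \<phi> (Suc i)) - int (j \<phi> i)\<bar> \<ge> 3)) \<and>
     disjoint_family_on (\<lambda>\<phi>. path_edges p (u \<circ> j \<phi>)) {2..n} \<and>
     inj_on a {1..n} \<and> a ` {1..n} \<subseteq> {1..(p - 3) div 2} \<and>
     edges G = path_edges p u \<union> (\<Union>\<phi>\<in>{2..n}. path_edges p (u \<circ> j \<phi>)) \<union>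
       (\<Union>\<phi>\<in>{1..n}. {{u 1, u (2 * a \<phi> + 1)}, {u p, u (2 * a \<phi> + 1)}})}"

definition LAU :: "nat \<Rightarrow> nat \<Rightarrow> nat \<Rightarrow> 'a ugraph set" where
  "LAU t p n = {(\<Union>k<t. verts (H k), \<Union>k<t. edges (H k)) | H.
     (\<forall>k<t. H k \<in> Luv p n) \<and> disjoint_family_on (\<lambda>k. verts (H k)) {..<t}}"

lemma card_path_edge:
  assumes "inj_on w {1..p}" "w ` {1..p} \<subseteq> V" "e \<in> path_edges p w"
  shows "e \<subseteq> V \<and> card e = 2"
proof -
  from assms(3) obtain i where i: "e = {w i, w (Suc i)}" "1 \<le> i" "i \<le> p - 1"
    unfolding path_edges_def by blast
  then have m: "i \<in> {1..p}" "Suc i \<in> {1..p}" by auto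
  with assms(1) have "w i \<noteq> w (Suc i)" by (metis inj_on_def n_not_Suc_n)
  with i m assms(2) show ?thesis by (auto simp: card_insert_if)
qed

text \<open>Simplicity is part of the notion of a Luv graph; with the above encoding it is automatic.\<close>

lemma Luv_simple_graph:
  assumes "G \<in> Luv p n" "p \<ge> 9"
  shows "simple_graph G"
proof -
  obtain u j a where
    u: "bij_betw u {1..p} (verts G)" and
    j: "\<And>\<phi>. \<phi> \<in> {2..n} \<Longrightarrow> bij_betw (j \<phi>) {1..p} {1..p}" and
    a: "a ` {1..n} \<subseteq> {1..(p - 3) div 2}" and
    E: "edges G = path_edges p u \<union> (\<Union>\<phi>\<in>{2..n}. path_edges p (u \<circ> j \<phi>)) \<union>
       (\<Union>\<phi>\<in>{1..n}. {{u 1, u (2 * a \<phi> + 1)}, {u p, u (2 * a \<phi> + 1)}})"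
    using assms(1) unfolding Luv_def mem_Collect_eq by (elim exE conjE) (rule that; simp)
  have inj: "inj_on u {1..p}" and img: "u ` {1..p} = verts G"
    using u by (auto simp: bij_betw_def)
  have "e \<subseteq> verts G \<and> card e = 2" if "e \<in> edges G" for e
  proof -
    consider "e \<in> path_edges p u"
      | \<phi> where "\<phi> \<in> {2..n}" "e \<in> path_edges p (u \<circ> j \<phi>)"
      | \<phi> where "\<phi> \<in> {1..n}" "e \<in> {{u 1, u (2 * a \<phi> + 1)}, {u p, u (2 * a \<phi> + 1)}}"
      using \<open>e \<in> edges G\<close> unfolding E by (elim UnE UN_E) metis+
    then show ?thesis
    proof cases
      case 1
      then show ?thesis using card_path_edge inj img by blast
    next
      case 2
      have "bij_betw (u \<circ> j \<phi>) {1..p} (verts G)"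
        using bij_betw_trans[OF j[OF 2(1)] u] .
      then show ?thesis using card_path_edge[OF _ _ 2(2)] by (auto simp: bij_betw_def)
    next
      case 3
      then obtain x where x: "x = 1 \<or> x = p" "e = {u x, u (2 * a \<phi> + 1)}" by auto
      have "a \<phi> \<in> {1..(p - 3) div 2}" using a 3(1) by blast
      then have m: "x \<in> {1..p}" "2 * a \<phi> + 1 \<in> {1..p}" "x \<noteq> 2 * a \<phi> + 1"
        using x(1) assms(2) by auto
      then have "u x \<noteq> u (2 * a \<phi> + 1)" using inj by (meson inj_onD)
      then show ?thesis using x(2) m img by (auto simp: card_insert_if)
    qed
  qed
  moreover have "finite (verts G)" using u bij_betw_finite by blast
  ultimately show ?thesis by (simp add: simple_graph_def)
qed

end

theory Submission
  imports Defs
begin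

text \<open>Each \<open>E\<^sup>\<phi> \<union> F\<^sup>\<phi>\<close> is a closed trail through all vertices that starts and ends in the hub
  \<open>u\<^bsub>2a+1\<^esub>\<close> and visits no other vertex twice. Along the trail, vertices of odd and even index
  alternate, except that the hub and both of its trail neighbours \<open>u\<^sub>1\<close>, \<open>u\<^sub>p\<close> are odd. Let there be
  \<open>N = n t\<close> trails with edges numbered \<open>0, \<dots>, p\<close>. On trail \<open>c\<close>, edge \<open>2k + 1\<close> gets label
  \<open>c + k N\<close>, and edge \<open>2k\<close> the complement of this label with respect to \<open>(p + 1) N + 1\<close>. Each
  passage through an odd vertex then contributes \<open>(p + 1) N + 1\<close>, each passage through an even one
  \<open>p N + 1\<close>, and the first and last edge together add to the hub an amount independent of the
  trail. So the even vertices, the odd non-hubs and the hubs form three colour classes. Two colours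
  do not suffice, because a path segment from \<open>u\<^sub>1\<close> to a hub closes up to an odd cycle.\<close>

section \<open>Decomposition of a Luv graph into closed trails\<close>

definition trail_edge :: "(nat \<Rightarrow> 'a) \<Rightarrow> nat \<Rightarrow> 'a set" where
  "trail_edge x i = {x i, x (Suc i)}"

text \<open>\<open>x \<phi> 0\<close> is the hub of the \<open>\<phi>\<close>-th trail and \<open>Q\<close> the set of vertices of odd index.\<close>

definition trail_decomposition ::
  "nat \<Rightarrow> nat \<Rightarrow> 'a ugraph \<Rightarrow> (nat \<Rightarrow> nat \<Rightarrow> 'a) \<Rightarrow> 'a set \<Rightarrow> bool" where
  "trail_decomposition p n G x Q \<longleftrightarrow>
     (\<forall>\<phi>\<in>{1..n}. bij_betw (x \<phi>) {1..p} (verts G) \<and> x \<phi> 0 \<in> verts G \<and> x \<phi> (Suc p) = x \<phi> 0 \<and>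
        x \<phi> 0 \<in> Q \<and> (\<forall>i\<in>{1..p}. x \<phi> i \<in> Q \<longleftrightarrow> odd i) \<and>
        (\<forall>\<psi>\<in>{1..n}. x \<phi> 0 \<noteq> x \<psi> 1 \<and> x \<phi> 0 \<noteq> x \<psi> p)) \<and>
     inj_on (\<lambda>\<phi>. x \<phi> 0) {1..n} \<and>
     bij_betw (\<lambda>(\<phi>, i). trail_edge (x \<phi>) i) ({1..n} \<times> {0..p}) (edges G)"

lemma path_edges_eq_image:
  "path_edges p w = trail_edge w ` {1..p - 1}"
  by (auto simp: path_edges_def trail_edge_def)

lemma trail_edge_inj_on:
  assumes "inj_on w {1..p}"
  shows "inj_on (trail_edge w) {1..p - 1}"
proof (rule inj_onI)
  fix i k assume i: "i \<in> {1..p - 1}" and k: "k \<in> {1..p - 1}"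
    and eq: "trail_edge w i = trail_edge w k"
  have "i \<in> {1..p}" "Suc i \<in> {1..p}" "k \<in> {1..p}" "Suc k \<in> {1..p}"
    using i k by auto
  then have "{i, Suc i} = {k, Suc k}"
    using eq inj_on_image_eq_iff[OF assms, of "{i, Suc i}" "{k, Suc k}"]
    by (simp add: trail_edge_def)
  then show "i = k" by (auto simp: doubleton_eq_iff)
qed

lemma parity_along_path:
  assumes "\<And>i. i \<in> {1..p - 1} \<Longrightarrow> odd \<bar>int (j (Suc i)) - int (j i)\<bar>"
    and "j 1 = (1::nat)" "1 \<le> i" "i \<le> p"
  shows "odd (j i) \<longleftrightarrow> odd i"
  using assms(3,4)
proof (induction i rule: dec_induct)
  case base
  then show ?case using assms(2) by simp
next
  case (step i)
  then have "odd \<bar>int (j (Suc i)) - int (j i)\<bar>" using assms(1) by simp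
  then show ?case using step by auto
qed

text \<open>The two edges of \<open>F\<^sup>\<phi>\<close> close the path
  \<open>E\<^sup>\<phi>\<close> at its hub. That no edge is used twice is read off from indices: hub
  edges join two odd indices, path edges have an odd index difference, and this difference has
  absolute value 1 on the first path and at least 3 on the others, which are disjoint from each
  other by assumption.\<close>

lemma Luv_trail_decomposition:
  assumes "G \<in> Luv p n" "p \<ge> 9" "odd p" "n \<ge> 1"
  shows "\<exists>x Q. trail_decomposition p n G x Q"
proof -
  obtain u j a where
    u: "bij_betw u {1..p} (verts G)" and
    j: "\<And>\<phi>. \<phi> \<in> {2..n} \<Longrightarrow> bij_betw (j \<phi>) {1..p} {1..p} \<and> j \<phi> 1 = 1 \<and> j \<phi> p = p \<and>
        (\<forall>i\<in>{1..p - 1}. odd \<bar>int (j \<phi> (Suc i)) - int (j \<phi> i)\<bar> \<and>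
                         \<bar>int (j \<phi> (Suc i)) - int (j \<phi> i)\<bar> \<ge> 3)" and
    disj: "disjoint_family_on (\<lambda>\<phi>. path_edges p (u \<circ> j \<phi>)) {2..n}" and
    inj_a: "inj_on a {1..n}" and a: "a ` {1..n} \<subseteq> {1..(p - 3) div 2}" and
    E: "edges G = path_edges p u \<union> (\<Union>\<phi>\<in>{2..n}. path_edges p (u \<circ> j \<phi>)) \<union>
       (\<Union>\<phi>\<in>{1..n}. {{u 1, u (2 * a \<phi> + 1)}, {u p, u (2 * a \<phi> + 1)}})"
    using assms(1) unfolding Luv_def mem_Collect_eq by (elim exE conjE) (rule that; simp)
  \<comment> \<open>\<open>y \<phi> i\<close> is the index of the vertex at position
    \<open>i\<close> of trail \<open>\<phi>\<close>. Positions \<open>0\<close> and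
    \<open>Suc p\<close> both carry the hub, positions \<open>1\<close> to \<open>p\<close> the
    path. Since \<open>u\<close> is injective, vertices and edges can be compared through their
    indices.\<close>
  define y where "y \<phi> i = (if i = 0 \<or> i = Suc p then 2 * a \<phi> + 1 else if \<phi> = 1 then i else j \<phi> i)"
    for \<phi> i
  define x where "x \<phi> i = u (y \<phi> i)" for \<phi> i
  have inj_u: "inj_on u {1..p}" and img_u: "u ` {1..p} = verts G"
    using u by (auto simp: bij_betw_def)
  have hub: "2 * a \<phi> + 1 \<in> {1..p}" "2 * a \<phi> + 1 \<noteq> 1" "2 * a \<phi> + 1 \<noteq> p" if "\<phi> \<in> {1..n}" for \<phi>
  proof -
    have "a \<phi> \<in> {1..(p - 3) div 2}" using a that by blast
    then show "2 * a \<phi> + 1 \<in> {1..p}" "2 * a \<phi> + 1 \<noteq> 1" "2 * a \<phi> + 1 \<noteq> p"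
      using \<open>p \<ge> 9\<close> by auto
  qed
  have y_path: "bij_betw (y \<phi>) {1..p} {1..p} \<and> y \<phi> 1 = 1 \<and> y \<phi> p = p" if "\<phi> \<in> {1..n}" for \<phi>
  proof (cases "\<phi> = 1")
    case True
    then have "bij_betw (y \<phi>) {1..p} {1..p} \<longleftrightarrow> bij_betw id {1..p} {1..p}"
      by (intro bij_betw_cong) (auto simp: y_def)
    then show ?thesis using True \<open>p \<ge> 9\<close> by (simp add: y_def)
  next
    case False
    then have "bij_betw (y \<phi>) {1..p} {1..p} \<longleftrightarrow> bij_betw (j \<phi>) {1..p} {1..p}"
      by (intro bij_betw_cong) (auto simp: y_def)
    then show ?thesis using False that j[of \<phi>] \<open>p \<ge> 9\<close> by (simp add: y_def)
  qed
  have y_diff: "odd \<bar>int (y \<phi> (Suc i)) - int (y \<phi> i)\<bar>"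
    "\<bar>int (y \<phi> (Suc i)) - int (y \<phi> i)\<bar> = 1 \<longleftrightarrow> \<phi> = 1"
    if "\<phi> \<in> {1..n}" "i \<in> {1..p - 1}" for \<phi> i
  proof -
    have 1: "\<phi> \<noteq> 1 \<Longrightarrow> \<phi> \<in> {2..n}" using that by auto
    then have "\<phi> \<noteq> 1 \<Longrightarrow> odd \<bar>int (j \<phi> (Suc i)) - int (j \<phi> i)\<bar> \<and> \<bar>int (j \<phi> (Suc i)) - int (j \<phi> i)\<bar> \<ge> 3"
      using j[OF 1] that by blast
    then show "odd \<bar>int (y \<phi> (Suc i)) - int (y \<phi> i)\<bar>"
      "\<bar>int (y \<phi> (Suc i)) - int (y \<phi> i)\<bar> = 1 \<longleftrightarrow> \<phi> = 1"
      using that by (auto simp: y_def)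
  qed
  have y_parity: "odd (y \<phi> i) \<longleftrightarrow> odd i" if "\<phi> \<in> {1..n}" "i \<in> {1..p}" for \<phi> i
    using parity_along_path[of p "y \<phi>" i] y_diff(1)[OF that(1)] y_path[OF that(1)] that by auto
  have y_hub: "y \<phi> 0 = 2 * a \<phi> + 1" "y \<phi> (Suc p) = 2 * a \<phi> + 1" for \<phi>
    by (auto simp: y_def)
  have y_ran: "y \<phi> i \<in> {1..p}" if "\<phi> \<in> {1..n}" "i \<le> Suc p" for \<phi> i
  proof (cases "i = 0 \<or> i = Suc p")
    case True
    then show ?thesis using y_hub hub[OF that(1)] by auto
  next
    case False
    then have "i \<in> {1..p}" using that by auto
    then show ?thesis using y_path[OF that(1)] bij_betwE by blast
  qed
  have x_edge: "trail_edge (x \<phi>) i = u ` trail_edge (y \<phi>) i" for \<phi> i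
    by (simp add: trail_edge_def x_def)
  have edge_eq: "trail_edge (x \<phi>) i = trail_edge (x \<psi>) k \<longleftrightarrow>
      trail_edge (y \<phi>) i = trail_edge (y \<psi>) k"
    if "\<phi> \<in> {1..n}" "i \<le> p" "\<psi> \<in> {1..n}" "k \<le> p" for \<phi> i \<psi> k
    unfolding x_edge using that y_ran
    by (intro inj_on_image_eq_iff[OF inj_u]) (simp_all add: trail_edge_def)
  have end_edge: "trail_edge (y \<phi>) 0 = {1, 2 * a \<phi> + 1}" "trail_edge (y \<phi>) p = {p, 2 * a \<phi> + 1}"
    if "\<phi> \<in> {1..n}" for \<phi>
    using y_path[OF that] y_hub by (auto simp: trail_edge_def)
  have path_x: "path_edges p (x \<phi>) = (if \<phi> = 1 then path_edges p u else path_edges p (u \<circ> j \<phi>))" for \<phi>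
  proof -
    have "trail_edge (x \<phi>) i = trail_edge (if \<phi> = 1 then u else u \<circ> j \<phi>) i"
      if "i \<in> {1..p - 1}" for i
    proof -
      have "i \<noteq> 0" "i \<noteq> Suc p" "i \<noteq> p" using that \<open>p \<ge> 9\<close> by auto
      then show ?thesis by (simp add: trail_edge_def x_def y_def)
    qed
    then show ?thesis unfolding path_edges_eq_image by (auto intro!: image_cong)
  qed

  have edges: "edges G = (\<lambda>(\<phi>, i). trail_edge (x \<phi>) i) ` ({1..n} \<times> {0..p})"
  proof -
    have n1: "{1..n} = insert 1 {2..n}" using \<open>n \<ge> 1\<close> by auto
    have p0: "{0..p} = {1..p - 1} \<union> {0, p}" by auto
    have "(\<lambda>(\<phi>, i). trail_edge (x \<phi>) i) ` ({1..n} \<times> {0..p}) =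
       (\<Union>\<phi>\<in>{1..n}. trail_edge (x \<phi>) ` {0..p})"
      by (auto simp: image_iff)
    also have "\<dots> = (\<Union>\<phi>\<in>{1..n}. path_edges p (x \<phi>)) \<union>
       (\<Union>\<phi>\<in>{1..n}. {trail_edge (x \<phi>) 0, trail_edge (x \<phi>) p})"
      unfolding path_edges_eq_image p0 image_Un by blast
    also have "(\<Union>\<phi>\<in>{1..n}. path_edges p (x \<phi>)) =
        path_edges p u \<union> (\<Union>\<phi>\<in>{2..n}. path_edges p (u \<circ> j \<phi>))"
      unfolding n1 path_x by auto
    also have "(\<Union>\<phi>\<in>{1..n}. {trail_edge (x \<phi>) 0, trail_edge (x \<phi>) p}) =
       (\<Union>\<phi>\<in>{1..n}. {{u 1, u (2 * a \<phi> + 1)}, {u p, u (2 * a \<phi> + 1)}})"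
      using end_edge by (intro SUP_cong) (auto simp: x_edge)
    finally show ?thesis using E by (simp only:)
  qed

  have inj: "inj_on (\<lambda>(\<phi>, i). trail_edge (x \<phi>) i) ({1..n} \<times> {0..p})"
  proof -
    have "\<phi> = \<psi> \<and> i = k"
      if \<phi>: "\<phi> \<in> {1..n}" and i: "i \<le> p" and \<psi>: "\<psi> \<in> {1..n}" and k: "k \<le> p"
        and eq: "trail_edge (y \<phi>) i = trail_edge (y \<psi>) k" for \<phi> i \<psi> k
    proof -
      \<comment> \<open>Parity of the index sum tells the two hub edges from the path edges;
        \<open>odd p\<close> is what makes the sum at position \<open>p\<close> even.\<close>
      have par: "even (\<Sum>(trail_edge (y \<phi>) i)) \<longleftrightarrow> i = 0 \<or> i = p"
        if "\<phi> \<in> {1..n}" "i \<le> p" for \<phi> i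
      proof (cases "i = 0 \<or> i = p")
        case True
        then show ?thesis using end_edge[OF that(1)] hub[OF that(1)] \<open>odd p\<close> by auto
      next
        case False
        then have "i \<in> {1..p - 1}" using that by auto
        then have "odd \<bar>int (y \<phi> (Suc i)) - int (y \<phi> i)\<bar>" using y_diff(1)[OF that(1)] by blast
        then have "odd (y \<phi> i + y \<phi> (Suc i))" "y \<phi> i \<noteq> y \<phi> (Suc i)" by auto
        then show ?thesis using False by (simp add: trail_edge_def)
      qed
      show ?thesis
      proof (cases "i = 0 \<or> i = p")
        case True
        then have "k = 0 \<or> k = p" using par[OF \<phi> i] par[OF \<psi> k] eq by simp
        \<comment> \<open>The index of a hub is neither 1 nor \<open>p\<close>, so which of these
          two lies in the edge determines its position, and the remaining index determines
          \<open>a \<phi>\<close>.\<close>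
        with True have "a \<phi> = a \<psi> \<and> i = k"
          using eq end_edge[OF \<phi>] end_edge[OF \<psi>] hub(2,3)[OF \<phi>] hub(2,3)[OF \<psi>] \<open>p \<ge> 9\<close>
          by (elim disjE; simp add: doubleton_eq_iff)
        then show ?thesis using inj_onD[OF inj_a] \<phi> \<psi> by blast
      next
        case False
        then have "\<not> (k = 0 \<or> k = p)" using par[OF \<phi> i] par[OF \<psi> k] eq by simp
        then have ik: "i \<in> {1..p - 1}" "k \<in> {1..p - 1}" using False i k by auto
        \<comment> \<open>The absolute difference does not depend on the direction in which a trail
          runs through the edge.\<close>
        have "\<bar>int (y \<phi> (Suc i)) - int (y \<phi> i)\<bar> = \<bar>int (y \<psi> (Suc k)) - int (y \<psi> k)\<bar>"
          using eq by (auto simp: trail_edge_def doubleton_eq_iff)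
        then have "\<phi> = 1 \<longleftrightarrow> \<psi> = 1" using y_diff(2)[OF \<phi> ik(1)] y_diff(2)[OF \<psi> ik(2)] by simp
        moreover have "\<phi> = \<psi>" if "\<phi> \<noteq> 1" "\<psi> \<noteq> 1"
        proof (rule ccontr)
          assume "\<phi> \<noteq> \<psi>"
          then have "path_edges p (u \<circ> j \<phi>) \<inter> path_edges p (u \<circ> j \<psi>) = {}"
            using disj that \<phi> \<psi> by (intro disjoint_family_onD[OF disj]) auto
          then have "path_edges p (x \<phi>) \<inter> path_edges p (x \<psi>) = {}"
            using that by (simp add: path_x)
          moreover have "trail_edge (x \<phi>) i = trail_edge (x \<psi>) k"
            using eq by (simp add: x_edge)
          ultimately show False using ik unfolding path_edges_eq_image by blast
        qed
        ultimately have "\<phi> = \<psi>" by blast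
        moreover have "inj_on (y \<phi>) {1..p}" using y_path[OF \<phi>] by (simp add: bij_betw_def)
        ultimately show ?thesis using trail_edge_inj_on ik eq by (metis inj_onD)
      qed
    qed
    then show ?thesis unfolding inj_on_def by (auto simp: edge_eq)
  qed

  have x_Q: "x \<phi> i \<in> u ` {k \<in> {1..p}. odd k} \<longleftrightarrow> odd (y \<phi> i)"
    if "\<phi> \<in> {1..n}" "i \<le> Suc p" for \<phi> i
    unfolding x_def using inj_u y_ran[OF that] by (auto dest: inj_onD)
  have x_eq: "x \<phi> i = x \<psi> k \<longleftrightarrow> y \<phi> i = y \<psi> k"
    if "\<phi> \<in> {1..n}" "i \<le> Suc p" "\<psi> \<in> {1..n}" "k \<le> Suc p" for \<phi> i \<psi> k
    unfolding x_def using inj_on_eq_iff[OF inj_u y_ran y_ran] that by blast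
  have "trail_decomposition p n G x (u ` {k \<in> {1..p}. odd k})"
    unfolding trail_decomposition_def
  proof (intro conjI ballI)
    fix \<phi> assume \<phi>: "\<phi> \<in> {1..n}"
    have "bij_betw (u \<circ> y \<phi>) {1..p} (verts G)"
      using bij_betw_trans[OF _ u] y_path[OF \<phi>] by blast
    then show "bij_betw (x \<phi>) {1..p} (verts G)" by (simp add: x_def[abs_def] comp_def)
    show "x \<phi> 0 \<in> verts G" using img_u y_ran[OF \<phi>] by (auto simp: x_def)
    show "x \<phi> (Suc p) = x \<phi> 0" by (simp add: x_def y_hub)
    show "x \<phi> 0 \<in> u ` {k \<in> {1..p}. odd k}" using x_Q[OF \<phi>, of 0] by (simp add: y_hub)
    show "x \<phi> i \<in> u ` {k \<in> {1..p}. odd k} \<longleftrightarrow> odd i" if "i \<in> {1..p}" for i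
      using \<phi> that y_parity[OF \<phi> that] x_Q[of \<phi> i] by simp
    show "x \<phi> 0 \<noteq> x \<psi> 1" "x \<phi> 0 \<noteq> x \<psi> p" if "\<psi> \<in> {1..n}" for \<psi>
      using x_eq[OF \<phi> _ that] y_path[OF that] hub[OF \<phi>] y_hub \<open>p \<ge> 9\<close> by auto
  next
    show "inj_on (\<lambda>\<phi>. x \<phi> 0) {1..n}"
    proof (rule inj_onI)
      fix \<phi> \<psi> assume "\<phi> \<in> {1..n}" "\<psi> \<in> {1..n}" "x \<phi> 0 = x \<psi> 0"
      then show "\<phi> = \<psi>" using x_eq[of \<phi> 0 \<psi> 0] y_hub(1) inj_onD[OF inj_a] by simp
    qed
    show "bij_betw (\<lambda>(\<phi>, i). trail_edge (x \<phi>) i) ({1..n} \<times> {0..p}) (edges G)"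
      using inj edges by (simp add: bij_betw_def)
  qed
  then show ?thesis by blast
qed

section \<open>Labels along the trails and their sums\<close>

definition trail_label :: "nat \<Rightarrow> nat \<Rightarrow> nat \<Rightarrow> nat \<Rightarrow> nat" where
  "trail_label N p c i =
     (if odd i then c + i div 2 * N else (p + 1) * N + 1 - (c + i div 2 * N))"

text \<open>Uniqueness of quotient and remainder, with remainders in \<open>{1..N}\<close> instead
  of \<open>{0..<N}\<close>. It separates the trail number from the edge position and, with
  \<open>n\<close> for \<open>N\<close>, the component from the trail within it.\<close>

lemma add_mult_eq_iff:
  fixes c d k l N :: nat
  assumes "c \<in> {1..N}" "d \<in> {1..N}"
  shows "c + k * N = d + l * N \<longleftrightarrow> c = d \<and> k = l"
proof
  assume eq: "c + k * N = d + l * N"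
  have *: "(c + k * N - 1) div N = k" if "c \<in> {1..N}" for c k :: nat
  proof -
    have "c + k * N - 1 = (c - 1) + k * N" "c - 1 < N" using that by auto
    then show ?thesis by simp
  qed
  have "k = l" using *[OF assms(1), of k] *[OF assms(2), of l] eq by simp
  then show "c = d \<and> k = l" using eq by simp
qed simp

lemma add_mult_le:
  fixes c k m N :: nat
  assumes "c \<in> {1..N}" "k < m"
  shows "1 \<le> c + k * N" "c + k * N \<le> m * N"
proof -
  have "c + k * N \<le> Suc k * N" using assms(1) by simp
  also have "\<dots> \<le> m * N" using assms(2) by (intro mult_right_mono) auto
  finally show "c + k * N \<le> m * N" .
qed (use assms in simp)

text \<open>The number \<open>\<phi> + k * n\<close> runs through \<open>{1..N}\<close> as component
  \<open>k\<close> and trail \<open>\<phi>\<close> vary. Odd positions fill the lower half of the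
  labels, even positions the upper half by reflection. Injectivity follows by decoding, surjectivity
  by counting.\<close>

lemma trail_label_bij:
  assumes "odd p" "N = n * t"
  shows "bij_betw (\<lambda>(k, \<phi>, i). trail_label N p (\<phi> + k * n) i)
    ({..<t} \<times> {1..n} \<times> {0..p}) {1..(p + 1) * N}" (is "bij_betw ?g ?I _")
proof -
  \<comment> \<open>\<open>m\<close> is the number of odd, and also of even, positions in
    \<open>{0..p}\<close>, so each half consists of \<open>m * N\<close> labels.\<close>
  obtain m where m: "p + 1 = 2 * m" using \<open>odd p\<close> by (metis even_Suc evenE Suc_eq_plus1)
  have c: "\<phi> + k * n \<in> {1..N}" if "k < t" "\<phi> \<in> {1..n}" for k \<phi>
    using add_mult_le[OF that(2,1)] assms(2) by (simp add: mult.commute)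
  have b: "1 \<le> (\<phi> + k * n) + i div 2 * N" "(\<phi> + k * n) + i div 2 * N \<le> m * N"
    if "k < t" "\<phi> \<in> {1..n}" "i \<le> p" for k \<phi> i
    using add_mult_le[OF c[OF that(1,2)], of "i div 2" m] m that by auto
  \<comment> \<open>The reflection of \<open>s\<close> to \<open>M + M + 1 - s\<close> exchanges the
    lower and the upper half. The half containing a label therefore reveals the parity of the
    position, and then \<open>s\<close> itself.\<close>
  have fold_eq: "even i = even h \<and> s = s'"
    if "1 \<le> s" "s \<le> M" "1 \<le> s'" "s' \<le> M"
      "(if odd i then s else M + M + 1 - s) = (if odd h then s' else M + M + 1 - s')"
    for s s' M i h :: nat
    using that by (auto split: if_splits)
  have inj: "inj_on ?g ?I"
  proof -
    have "k = l \<and> \<phi> = \<psi> \<and> i = h"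
      if A: "k < t" "\<phi> \<in> {1..n}" "i \<le> p" "l < t" "\<psi> \<in> {1..n}" "h \<le> p"
        and eq: "trail_label N p (\<phi> + k * n) i = trail_label N p (\<psi> + l * n) h"
      for k l \<phi> \<psi> i h
    proof -
      let ?s = "(\<phi> + k * n) + i div 2 * N" and ?s' = "(\<psi> + l * n) + h div 2 * N"
      have M: "(p + 1) * N = m * N + m * N" unfolding m by simp
      have "even i = even h \<and> ?s = ?s'"
        using fold_eq[OF b[OF A(1-3)] b[OF A(4-6)]] eq unfolding trail_label_def M by blast
      moreover from this have "\<phi> + k * n = \<psi> + l * n" "i div 2 = h div 2"
        using add_mult_eq_iff[OF c[OF A(1,2)] c[OF A(4,5)]] by blast+
      moreover from this have "\<phi> = \<psi>" "k = l" using add_mult_eq_iff[OF A(2,5)] by blast+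
      ultimately show ?thesis by (metis bit_eq_rec even_iff_mod_2_eq_zero)
    qed
    then show ?thesis by (auto simp: inj_on_def)
  qed
  have "?g ` ?I \<subseteq> {1..(p + 1) * N}"
  proof (rule image_subsetI)
    fix z assume "z \<in> ?I"
    then obtain k \<phi> i where z: "z = (k, \<phi>, i)" and A: "k \<in> {..<t}" "\<phi> \<in> {1..n}" "i \<in> {0..p}"
      by auto
    have "(p + 1) * N = m * N + m * N" unfolding m by simp
    then show "?g z \<in> {1..(p + 1) * N}"
      using b[of k \<phi> i] A unfolding trail_label_def z by (auto simp del: mult_Suc)
  qed
  moreover have "card ?I = card {1..(p + 1) * N}"
    using assms(2) by (simp add: card_cartesian_product algebra_simps)
  ultimately have "?g ` ?I = {1..(p + 1) * N}"
    using inj by (intro card_subset_eq) (auto simp: card_image)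
  then show ?thesis using inj by (simp add: bij_betw_def)
qed

text \<open>Edges \<open>2k\<close> and \<open>2k + 1\<close> have complementary labels; passing on
  to edge \<open>2k + 2\<close> lowers the complement by a further \<open>N\<close>. For the closing
  pair, \<open>c\<close> cancels between edge \<open>0\<close> and edge \<open>p\<close>.\<close>

lemma trail_label_sums:
  assumes "c \<in> {1..N}" "odd p"
  shows "i \<in> {1..p} \<Longrightarrow> trail_label N p c (i - 1) + trail_label N p c i =
      (if odd i then (p + 1) * N + 1 else p * N + 1)"
    and "trail_label N p c 0 + trail_label N p c p = (p + 1) * N + 1 + (p div 2) * N"
proof -
  obtain m where m: "p = 2 * m + 1" using \<open>odd p\<close> by (elim oddE)
  \<comment> \<open>Guarantees that the subtraction in \<open>trail_label\<close> is never
    truncated.\<close>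
  have le: "c + k * N \<le> (p + 1) * N" if "k \<le> m" for k
    using add_mult_le(2)[OF assms(1), of k "p + 1"] that m by simp
  show "trail_label N p c (i - 1) + trail_label N p c i =
      (if odd i then (p + 1) * N + 1 else p * N + 1)" if i: "i \<in> {1..p}"
  proof (cases "odd i")
    case True
    then obtain k where k: "i = 2 * k + 1" by (elim oddE)
    then have "k \<le> m" using i m by auto
    then show ?thesis using le[of k] by (simp add: trail_label_def k)
  next
    case False
    then obtain l where l: "i = 2 * l" by (auto elim: evenE)
    with i obtain k where "l = Suc k" by (cases l) auto
    with l have k: "i = 2 * k + 2" by simp
    then have "Suc k \<le> m" using i m by auto
    then show ?thesis using le[of "Suc k"] by (simp add: trail_label_def k)
  qed
  show "trail_label N p c 0 + trail_label N p c p = (p + 1) * N + 1 + (p div 2) * N"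
    using le[of 0] m by (simp add: trail_label_def)
qed

text \<open>A vertex occupies exactly one position \<open>q\<close> in \<open>{1..p}\<close>,
  between edges \<open>q - 1\<close> and \<open>q\<close>. The hub additionally occupies positions
  \<open>0\<close> and \<open>Suc p\<close>, which brings in edges \<open>0\<close> and
  \<open>p\<close>.\<close>

lemma trail_vertex_sum:
  assumes D: "trail_decomposition p n G x Q" and \<phi>: "\<phi> \<in> {1..n}" and v: "v \<in> verts G"
    and p: "p \<ge> 2" "odd p" and c: "c \<in> {1..N}"
  shows "(\<Sum>i | i \<in> {0..p} \<and> v \<in> trail_edge (x \<phi>) i. trail_label N p c i) =
    (if v \<in> Q then (p + 1) * N + 1 else p * N + 1) +
    (if v = x \<phi> 0 then (p + 1) * N + 1 + (p div 2) * N else 0)"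
proof -
  have bij: "bij_betw (x \<phi>) {1..p} (verts G)" and last: "x \<phi> (Suc p) = x \<phi> 0"
    and par: "\<And>i. i \<in> {1..p} \<Longrightarrow> x \<phi> i \<in> Q \<longleftrightarrow> odd i"
    and ends: "x \<phi> 0 \<noteq> x \<phi> 1" "x \<phi> 0 \<noteq> x \<phi> p"
    using D \<phi> unfolding trail_decomposition_def by blast+
  obtain q where q: "q \<in> {1..p}" "v = x \<phi> q" using bij v unfolding bij_betw_def by blast
  have eq: "v = x \<phi> i \<longleftrightarrow> i = q" if "i \<in> {1..p}" for i
    using inj_on_eq_iff[OF bij_betw_imp_inj_on[OF bij]] q that by auto
  define h where "h \<longleftrightarrow> v = x \<phi> 0"
  have at: "v = x \<phi> i \<longleftrightarrow> i = q \<or> (i = 0 \<or> i = Suc p) \<and> h" if "i \<le> Suc p" for i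
    using eq[of i] last that q(1) by (cases "i = 0 \<or> i = Suc p") (auto simp: h_def)
  have "v \<in> trail_edge (x \<phi>) i \<longleftrightarrow> i = q - 1 \<or> i = q \<or> (i = 0 \<or> i = p) \<and> h" if "i \<le> p" for i
  proof -
    have "v \<in> trail_edge (x \<phi>) i \<longleftrightarrow> v = x \<phi> i \<or> v = x \<phi> (Suc i)"
      by (simp add: trail_edge_def)
    also have "\<dots> \<longleftrightarrow> i = q - 1 \<or> i = q \<or> (i = 0 \<or> i = p) \<and> h"
      using at[of i] at[of "Suc i"] that q(1) by auto
    finally show ?thesis .
  qed
  then have indices: "{i. i \<in> {0..p} \<and> v \<in> trail_edge (x \<phi>) i} =
      {q - 1, q} \<union> (if h then {0, p} else {})"
    using q(1) by auto
  \<comment> \<open>The pairs of edges could only overlap for \<open>q = 1\<close> or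
    \<open>q = p\<close>, where the hub would coincide with a trail neighbour.\<close>
  have disj: "{q - 1, q} \<inter> (if h then {0, p} else {}) = {}"
  proof (cases h)
    case True
    then have "q \<noteq> 1" "q \<noteq> p" using ends q(2) by (auto simp: h_def)
    then show ?thesis using q(1) by auto
  qed simp
  have "q - 1 \<noteq> q" using q(1) by auto
  then have "(\<Sum>i\<in>{q - 1, q}. trail_label N p c i) =
      (if v \<in> Q then (p + 1) * N + 1 else p * N + 1)"
    using trail_label_sums(1)[OF c p(2) q(1)] par[OF q(1)] q(2) by simp
  moreover have "(\<Sum>i\<in>(if h then {0, p} else {}). trail_label N p c i) =
      (if h then (p + 1) * N + 1 + (p div 2) * N else 0)"
    using trail_label_sums(2)[OF c p(2)] p(1) by simp
  ultimately show ?thesis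
    unfolding indices h_def[symmetric] using disj by (subst sum.union_disjoint) simp_all
qed

section \<open>Lower bound by an odd cycle\<close>

text \<open>With only two colours, all odd positions of the first trail share the colour of position
  \<open>1\<close>. The hub recurs at an odd position, yet edge \<open>0\<close> joins it to
  position \<open>1\<close>. The larger set \<open>V\<close> allows \<open>G\<close> to be one
  component of a disconnected graph.\<close>

lemma card_trail_colouring_ge_3:
  assumes D: "trail_decomposition p n G x Q" and n: "n \<ge> 1" and p: "p \<ge> 1"
    and V: "finite V" "verts G \<subseteq> V"
    and proper: "\<And>u v. {u, v} \<in> edges G \<Longrightarrow> col u \<noteq> col v"
  shows "card (col ` V) \<ge> 3"
proof (rule ccontr)
  assume "\<not> card (col ` V) \<ge> 3"
  \<comment> \<open>Among at most two colours, any two that differ from a third coincide.\<close>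
  have two: "r = s" if "r \<in> col ` V" "s \<in> col ` V" "q \<in> col ` V" "r \<noteq> q" "s \<noteq> q" for r s q
  proof (rule ccontr)
    assume "r \<noteq> s"
    then have "card {r, s, q} = 3" using that by simp
    moreover have "card {r, s, q} \<le> card (col ` V)" using that V by (intro card_mono) auto
    ultimately show False using \<open>\<not> card (col ` V) \<ge> 3\<close> by simp
  qed
  have 1: "1 \<in> {1..n}" using n by simp
  have bij: "bij_betw (x 1) {1..p} (verts G)" and hub: "x 1 0 \<in> Q" "x 1 0 \<in> verts G"
    and par: "\<And>i. i \<in> {1..p} \<Longrightarrow> x 1 i \<in> Q \<longleftrightarrow> odd i"
    and bijE: "bij_betw (\<lambda>(\<phi>, i). trail_edge (x \<phi>) i) ({1..n} \<times> {0..p}) (edges G)"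
    using D 1 unfolding trail_decomposition_def by blast+
  have step: "col (x 1 i) \<noteq> col (x 1 (Suc i))" if "i \<le> p" for i
    using bij_betw_apply[OF bijE, of "(1, i)"] 1 that by (auto simp: trail_edge_def intro!: proper)
  have mem: "col (x 1 i) \<in> col ` V" if "i \<in> {1..p}" for i
    using bij_betw_apply[OF bij that] V by blast
  have odd_col: "2 * k + 1 \<le> p \<Longrightarrow> col (x 1 (2 * k + 1)) = col (x 1 1)" for k
  proof (induction k)
    case (Suc k)
    have "col (x 1 (2 * k + 3)) = col (x 1 (2 * k + 1))"
      using step[of "2 * k + 1"] step[of "2 * k + 2"] Suc.prems
      by (intro two[where q = "col (x 1 (2 * k + 2))"] mem) (auto simp: numeral_eq_Suc)
    then show ?case using Suc by (simp add: numeral_eq_Suc)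
  qed simp
  obtain q where q: "q \<in> {1..p}" "x 1 0 = x 1 q" using bij hub(2) unfolding bij_betw_def by blast
  then have "odd q" using par hub(1) by metis
  then obtain k where "q = 2 * k + 1" by (elim oddE)
  then have "col (x 1 0) = col (x 1 1)" using odd_col[of k] q by simp
  then show False using step[of 0] by simp
qed

section \<open>Labeling of a disjoint union of Luv graphs\<close>

theorem theorem2p1:
  fixes t n p :: nat and G :: "'a ugraph"
  assumes "t \<ge> 1" and "n \<ge> 2" and "p \<ge> 9" and "odd p"
    and "G \<in> LAU t p n"
  shows "chi_la G = 3"
proof -
  obtain H where G: "G = (\<Union>k<t. verts (H k), \<Union>k<t. edges (H k))"
    and H: "\<And>k. k < t \<Longrightarrow> H k \<in> Luv p n" and disj: "disjoint_family_on (\<lambda>k. verts (H k)) {..<t}"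
    using assms(5) unfolding LAU_def by auto
  have VG: "verts G = (\<Union>k<t. verts (H k))" and EG: "edges G = (\<Union>k<t. edges (H k))"
    using G by simp_all
  have "\<exists>x Q. trail_decomposition p n (H k) x Q" if "k < t" for k
    using Luv_trail_decomposition[OF H[OF that]] assms by simp
  then obtain x Q where D: "\<And>k. k < t \<Longrightarrow> trail_decomposition p n (H k) (x k) (Q k)"
    by metis
  define N where "N = n * t"
  define I where "I = {..<t} \<times> {1..n} \<times> {0..p}"
  define e where "e = (\<lambda>(k, \<phi>, i). trail_edge (x k \<phi>) i)"
  define g where "g = (\<lambda>(k, \<phi>, i). trail_label N p (\<phi> + k * n) i)"
  have N: "N \<ge> 1" using assms by (simp add: N_def)
  \<comment> \<open>All \<open>N\<close> trails of all components are numbered jointly, so that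
    together they share one range of labels.\<close>
  have c: "\<phi> + k * n \<in> {1..N}" if "k < t" "\<phi> \<in> {1..n}" for k \<phi>
    using add_mult_le[OF that(2,1)] by (simp add: N_def mult.commute)
  have simple: "simple_graph (H k)" if "k < t" for k
    using Luv_simple_graph H[OF that] assms(3) by blast
  have bijE: "bij_betw (\<lambda>(\<phi>, i). trail_edge (x k \<phi>) i) ({1..n} \<times> {0..p}) (edges (H k))"
    if "k < t" for k
    using D[OF that] unfolding trail_decomposition_def by blast
  have e_mem: "trail_edge (x k \<phi>) i \<in> edges (H k)"
    if "k < t" "\<phi> \<in> {1..n}" "i \<in> {0..p}" for k \<phi> i
    using bij_betw_apply[OF bijE[OF that(1)], of "(\<phi>, i)"] that by simp
  have same_comp: "k = l" if "k < t" "l < t" "v \<in> verts (H k)" "v \<in> verts (H l)" for k l v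
    using disjoint_family_onD[OF disj, of k l] that by auto
  have edge_verts: "E \<subseteq> verts (H k) \<and> card E = 2" if "k < t" "E \<in> edges (H k)" for k E
    using simple[OF that(1)] that(2) by (simp add: simple_graph_def)
  \<comment> \<open>Within a component this is the trail decomposition; across components, edges
    differ because the vertex sets are disjoint.\<close>
  have e_bij: "bij_betw e I (edges G)"
    unfolding bij_betw_def
  proof
    show "inj_on e I"
    proof (rule inj_onI, clarsimp simp: I_def e_def)
      fix k \<phi> i l \<psi> h
      assume A: "k < t" "Suc 0 \<le> \<phi>" "\<phi> \<le> n" "i \<le> p" "l < t" "Suc 0 \<le> \<psi>" "\<psi> \<le> n" "h \<le> p"
        and eq: "trail_edge (x k \<phi>) i = trail_edge (x l \<psi>) h"
      have "trail_edge (x k \<phi>) i \<subseteq> verts (H k)" "trail_edge (x k \<phi>) i \<subseteq> verts (H l)"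
        using edge_verts[OF A(1) e_mem[of k \<phi> i]] edge_verts[OF A(5) e_mem[of l \<psi> h]] A
        by (simp_all add: eq)
      then have "x k \<phi> i \<in> verts (H k)" "x k \<phi> i \<in> verts (H l)"
        by (auto simp: trail_edge_def)
      then have "k = l" using same_comp A by blast
      then show "k = l \<and> \<phi> = \<psi> \<and> i = h"
        using inj_onD[OF bij_betw_imp_inj_on[OF bijE[OF A(1)]], of "(\<phi>, i)" "(\<psi>, h)"] A eq by simp
    qed
    have "e ` I = (\<Union>k<t. (\<lambda>(\<phi>, i). trail_edge (x k \<phi>) i) ` ({1..n} \<times> {0..p}))"
      by (force simp: I_def e_def)
    also have "\<dots> = (\<Union>k<t. edges (H k))"
      using bijE by (simp add: bij_betw_def)
    finally show "e ` I = edges G" unfolding EG .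
  qed
  have g_bij: "bij_betw g I {1..(p + 1) * N}"
    unfolding g_def I_def using trail_label_bij[OF assms(4) N_def] .
  \<comment> \<open>The labels \<open>g\<close>, given on triples (component, trail, position), are
    transported to edges along \<open>e\<close>.\<close>
  define f where "f = g \<circ> the_inv_into I e"
  have f_e: "f (e z) = g z" if "z \<in> I" for z
    using that the_inv_into_f_f[OF bij_betw_imp_inj_on[OF e_bij]] by (simp add: f_def)
  have f_bij: "bij_betw f (edges G) {1..(p + 1) * N}"
    unfolding f_def using bij_betw_trans[OF bij_betw_the_inv_into[OF e_bij] g_bij] .
  then have f_bij': "bij_betw f (edges G) {1..card (edges G)}"
    using bij_betw_same_card[OF f_bij] by simp

  \<comment> \<open>\<open>B\<close> and \<open>A\<close> are the contributions of one passage
    through an odd and an even vertex, \<open>C\<close> is the extra contribution of the closing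
    edges at a hub.\<close>
  define B where "B = (p + 1) * N + 1"
  define A where "A = p * N + 1"
  define C where "C = B + p div 2 * N"
  define hubs where "hubs k = (\<lambda>\<phi>. x k \<phi> 0) ` {1..n}" for k
  have AB: "A < B" and C: "C > 0" using N by (auto simp: A_def B_def C_def)
  \<comment> \<open>Each of the \<open>n\<close> trails of its component passes through
    \<open>v\<close>, and the sum of a passage is independent of the trail. The extra
    \<open>C\<close> occurs at most once since distinct trails have distinct hubs.\<close>
  have sum_v: "vertex_sum G f v = n * (if v \<in> Q k then B else A) + (if v \<in> hubs k then C else 0)"
    if k: "k < t" and v: "v \<in> verts (H k)" for k v
  proof -
    let ?J = "\<lambda>\<phi>. {i. i \<in> {0..p} \<and> v \<in> trail_edge (x k \<phi>) i}"
    have "{E. E \<in> edges G \<and> v \<in> E} = e ` {z \<in> I. v \<in> e z}"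
      using e_bij by (auto simp: bij_betw_def)
    moreover have "inj_on e {z \<in> I. v \<in> e z}"
      by (rule inj_on_subset[OF bij_betw_imp_inj_on[OF e_bij]]) auto
    ultimately have "vertex_sum G f v = (\<Sum>z\<in>{z \<in> I. v \<in> e z}. f (e z))"
      unfolding vertex_sum_def by (simp only: sum.reindex comp_def)
    also have "\<dots> = (\<Sum>z\<in>{z \<in> I. v \<in> e z}. g z)"
      by (intro sum.cong) (auto simp: f_e)
    also have "{z \<in> I. v \<in> e z} = Pair k ` (SIGMA \<phi>:{1..n}. ?J \<phi>)"
    proof
      show "{z \<in> I. v \<in> e z} \<subseteq> Pair k ` (SIGMA \<phi>:{1..n}. ?J \<phi>)"
      proof clarify
        fix l \<phi> i assume z: "(l, \<phi>, i) \<in> I" "v \<in> e (l, \<phi>, i)"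
        then have "v \<in> verts (H l)"
          using edge_verts[of l "trail_edge (x l \<phi>) i"] e_mem[of l \<phi> i] by (auto simp: I_def e_def)
        then have "l = k" using same_comp k v z by (auto simp: I_def)
        then show "(l, \<phi>, i) \<in> Pair k ` (SIGMA \<phi>:{1..n}. ?J \<phi>)"
          using z by (auto simp: I_def e_def)
      qed
    qed (use k in \<open>auto simp: I_def e_def\<close>)
    also have "(\<Sum>z\<in>Pair k ` (SIGMA \<phi>:{1..n}. ?J \<phi>). g z) =
        (\<Sum>(\<phi>, i)\<in>(SIGMA \<phi>:{1..n}. ?J \<phi>). trail_label N p (\<phi> + k * n) i)"
      by (subst sum.reindex) (auto simp: g_def inj_on_def intro!: sum.cong)
    also have "\<dots> = (\<Sum>\<phi>\<in>{1..n}. \<Sum>i\<in>?J \<phi>. trail_label N p (\<phi> + k * n) i)"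
      by (subst sum.Sigma) auto
    also have "\<dots> = (\<Sum>\<phi>\<in>{1..n}. (if v \<in> Q k then B else A) + (if v = x k \<phi> 0 then C else 0))"
    proof (rule sum.cong)
      fix \<phi> assume "\<phi> \<in> {1..n}"
      with trail_vertex_sum[OF D[OF k] this v _ assms(4) c[OF k this]] assms(3)
      show "(\<Sum>i\<in>?J \<phi>. trail_label N p (\<phi> + k * n) i) =
          (if v \<in> Q k then B else A) + (if v = x k \<phi> 0 then C else 0)"
        by (simp only: A_def B_def C_def)
    qed simp
    also have "\<dots> = n * (if v \<in> Q k then B else A) + (\<Sum>\<phi>\<in>{1..n}. if v = x k \<phi> 0 then C else 0)"
      by (simp add: sum.distrib)
    also have "(\<Sum>\<phi>\<in>{1..n}. if v = x k \<phi> 0 then C else 0) = (\<Sum>w\<in>hubs k. if v = w then C else 0)"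
      using D[OF k] unfolding hubs_def trail_decomposition_def
      by (subst sum.reindex) auto
    also have "\<dots> = (if v \<in> hubs k then C else 0)"
      by (simp add: hubs_def)
    finally show ?thesis .
  qed

  have sum_Q: "vertex_sum G f v = n * A \<or> vertex_sum G f v = n * B \<or> vertex_sum G f v = n * B + C"
    if v: "v \<in> verts G" for v
  proof -
    obtain k where k: "k < t" "v \<in> verts (H k)" using v unfolding VG by blast
    have "hubs k \<subseteq> Q k" using D[OF k(1)] by (auto simp: hubs_def trail_decomposition_def)
    then show ?thesis using sum_v[OF k] by auto
  qed
  have "vertex_sum G f ` verts G \<subseteq> {n * A, n * B, n * B + C}" using sum_Q by blast
  then have "card (vertex_sum G f ` verts G) \<le> card {n * A, n * B, n * B + C}"
    by (intro card_mono) auto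
  also have "\<dots> \<le> 3" by (simp add: card_insert_if)
  finally have le3: "card (vertex_sum G f ` verts G) \<le> 3" .

  define nA nB where "nA = n * A" and "nB = n * B"
  have nAB: "nA < nB" using AB assms(2) by (simp add: nA_def nB_def)
  have sum_v': "vertex_sum G f v = (if v \<in> Q k then nB else nA) + (if v \<in> hubs k then C else 0)"
    if "k < t" "v \<in> verts (H k)" for k v
    using sum_v[OF that] by (simp add: nA_def nB_def)
  \<comment> \<open>An edge at position \<open>0\<close> or \<open>p\<close> joins a hub, with sum
    \<open>nB + C\<close>, to an odd non-hub, with sum \<open>nB\<close>. Every other edge joins an
    even vertex, with sum \<open>nA\<close>, to an odd one, with sum at least
    \<open>nB\<close>.\<close>
  have distinct: "vertex_sum G f (x k \<phi> i) \<noteq> vertex_sum G f (x k \<phi> (Suc i))"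
    if k: "k < t" and \<phi>: "\<phi> \<in> {1..n}" and i: "i \<in> {0..p}" for k \<phi> i
  proof -
    have hub: "x k \<phi> 0 \<in> hubs k" using \<phi> by (simp add: hubs_def)
    have last: "x k \<phi> (Suc p) = x k \<phi> 0"
      and par: "\<And>i. i \<in> {1..p} \<Longrightarrow> x k \<phi> i \<in> Q k \<longleftrightarrow> odd i"
      using D[OF k] \<phi> unfolding trail_decomposition_def by blast+
    have "w \<in> Q k \<and> w \<noteq> x k \<phi> 1 \<and> w \<noteq> x k \<phi> p" if "w \<in> hubs k" for w
    proof -
      obtain \<psi> where \<psi>: "\<psi> \<in> {1..n}" "w = x k \<psi> 0"
        using \<open>w \<in> hubs k\<close> by (auto simp: hubs_def)
      have "x k \<psi> 0 \<in> Q k \<and> x k \<psi> 0 \<noteq> x k \<phi> 1 \<and> x k \<psi> 0 \<noteq> x k \<phi> p"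
        using D[OF k] \<phi> \<psi>(1) unfolding trail_decomposition_def by blast
      then show ?thesis using \<psi>(2) by simp
    qed
    then have hubQ: "hubs k \<subseteq> Q k" and ends: "x k \<phi> 1 \<notin> hubs k" "x k \<phi> p \<notin> hubs k"
      by blast+
    have mem: "x k \<phi> i \<in> verts (H k)" "x k \<phi> (Suc i) \<in> verts (H k)"
      using edge_verts[OF k e_mem[OF k \<phi> i]] by (auto simp: trail_edge_def)
    note sums = sum_v'[OF k mem(1)] sum_v'[OF k mem(2)]
    consider "i = 0" | "i = p" | "i \<in> {1..p - 1}" using i by force
    then show ?thesis
    proof cases
      case 1
      then show ?thesis using sums hub hubQ ends par[of 1] C assms(3) by auto
    next
      case 2
      then show ?thesis using sums hub hubQ ends par[of p] C assms(3,4) last by auto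
    next
      case 3
      then have "i \<in> {1..p}" "Suc i \<in> {1..p}" by auto
      then have "x k \<phi> i \<in> Q k \<longleftrightarrow> x k \<phi> (Suc i) \<notin> Q k" using par by simp
      then show ?thesis using sums hubQ nAB by (auto split: if_splits)
    qed
  qed
  have "vertex_sum G f v \<noteq> vertex_sum G f w" if "{v, w} \<in> edges G" for v w
  proof -
    have "{v, w} \<in> e ` I" using that e_bij by (simp add: bij_betw_def)
    then obtain k \<phi> i where "k < t" "\<phi> \<in> {1..n}" "i \<in> {0..p}" "{v, w} = {x k \<phi> i, x k \<phi> (Suc i)}"
      by (auto simp: I_def e_def trail_edge_def)
    then show ?thesis using distinct[of k \<phi> i] by (auto simp: doubleton_eq_iff)
  qed
  then have lab: "local_antimagic_labeling G f"
    using f_bij' by (simp add: local_antimagic_labeling_def)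

  \<comment> \<open>Any local antimagic labeling properly colours component \<open>0\<close>, which
    exists because \<open>t \<ge> 1\<close>.\<close>
  have ge3: "card (vertex_sum G f' ` verts G) \<ge> 3" if "local_antimagic_labeling G f'" for f'
  proof (rule card_trail_colouring_ge_3[OF D[of 0]])
    have 0: "0 \<in> {..<t}" using assms(1) by simp
    show "finite (verts G)" using simple by (auto simp: VG simple_graph_def)
    show "verts (H 0) \<subseteq> verts G" using 0 unfolding VG by blast
    show "vertex_sum G f' u \<noteq> vertex_sum G f' v" if "{u, v} \<in> edges (H 0)" for u v
    proof -
      have "{u, v} \<in> edges G" using that 0 unfolding EG by blast
      then show ?thesis
        using \<open>local_antimagic_labeling G f'\<close> unfolding local_antimagic_labeling_def by blast
    qed
  qed (use assms in auto)
  show ?thesis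
    unfolding chi_la_def
  proof (rule cInf_eq_minimum)
    show "3 \<in> {card (vertex_sum G f ` verts G) | f. local_antimagic_labeling G f}"
      using lab le3 ge3[OF lab] by (auto intro!: exI[of _ f])
  qed (use ge3 in auto)
qed

end
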